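(* Let $f$ be the function defined on $[0,+\infty)$ by $f(x)=\dfrac{1}{1+2\lfloor x\rfloor-x}$. The Calkin-Wilf sequence $(x_n)_{n\geqslant 0}$, the sequence $(t_n)_{n\geqslant 0}$ and the sequence $(s_n)_{n\geqslant 0}$ are the only sequences $(u_n)_{n\geqslant 0}$ which enumerate the positive rationals and are defined by $u_0=0$ and a recurrence relation of the form $$u_n=\frac{f(u_{n-1})}{k}\quad\text{for every integer } n\geqslant 1,$$ where $k$ is a positive integer. That is, a sequence $(u_n)_{n\geqslant 0}$ satisfies $u_0=0$, satisfies such a recurrence for some integer $k\geqslant 1$, and enumerates the positive rationals, if and only if it is one of the three sequences $(x_n)$, $(t_n)$, $(s_n)$.
   Context: $\lfloor x\rfloor$ denotes the integral part of $x$. A sequence $(u_n)_{n\geqslant 0}$ with $u_0=0$ enumerates the positive rationals if $n\mapsto u_n$ is a bijection from $\{1,2,3,\dots\}$ to the set of positive rational numbers. Calkin-Wilf sequence: $x_0=0$, and $(x_n)_{n\geqslant 1}$ lists the vertices of the Calkin-Wilf tree level by level, from left to right. This is the binary tree with top $\frac11$ in which the vertex labeled $\frac{a}{b}$ has left child $\frac{a}{a+b}$ and right child $\frac{a+b}{b}$. Thus $x_1=1$ and, if $x_n=\frac{a}{b}$ in this labeling, then $x_{2n}=\frac{a}{a+b}$ and $x_{2n+1}=\frac{a+b}{b}$. Sequence $(t_n)$: define triples of integers $N_n=(a_n;b_n;c_n)$, $n\geqslant 1$, by $N_1=(1;2;0)$ and, for every $n\geqslant 1$, writing $N_n=(a;b;c)$: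 - if $b$ is odd: $N_{3n-1}=(4(c+1)a-b;\,2a;\,0)$, $N_{3n}=(a;\,2a+b;\,c+1)$, $N_{3n+1}=(2a+b;\,2a+2b;\,0)$; - if $b$ is even: $N_{3n-1}=(2(c+1)a-\frac{b}{2};\,a;\,0)$, $N_{3n}=(a;\,2a+b;\,c+1)$, $N_{3n+1}=(a+\frac{b}{2};\,a+b;\,0)$. Then $t_0=0$ and $t_n=\frac{a_n}{b_n}$ for $n\geqslant 1$. Sequence $(s_n)$: define triples of integers $M_n=(a'_n;b'_n;c'_n)$, $n\geqslant 1$, by $M_1=(1;3;0)$ and, for every $n\geqslant 1$, writing $M_n=(a;b;c)$: - if $3\nmid b$: $M_{5n-3}=(3(4c+3)a-2b;\,3(6c+5)a-3b;\,0)$, $M_{5n-2}=((6c+5)a-b;\,6(c+1)a-b;\,0)$, $M_{5n-1}=(6(c+1)a-b;\,3a;\,0)$, $M_{5n}=(a;\,3a+b;\,c+1)$, $M_{5n+1}=(3a+b;\,6a+3b;\,0)$; - if $3\mid b$: $M_{5n-3}=((4c+3)a-\frac{2b}{3};\,(6c+5)a-b;\,0)$, $M_{5n-2}=((6c+5)a-b;\,6(c+1)a-b;\,0)$, $M_{5n-1}=(2(c+1)a-\frac{b}{3};\,a;\,0)$, $M_{5n}=(a;\,3a+b;\,c+1)$, $M_{5n+1}=(a+\frac{b}{3};\,2a+b;\,0)$. Then $s_0=0$ and $s_n=\frac{a'_n}{b'_n}$ for $n\geqslant 1$. *)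

theory Defs
  imports Complex_Main
begin

(* The function f of the recurrence is meant on {0..} only. A sequence that satisfies the
   recurrence u n = newman_f (u (n - 1)) / k and starts at 0 never leaves {0..}: see
   newman_f_pos. *)
definition newman_f :: "real \<Rightarrow> real" where
  "newman_f x = 1 / (1 + 2 * real_of_int \<lfloor>x\<rfloor> - x)"

lemma newman_f_pos:
  assumes "0 \<le> x"
  shows "0 < newman_f x"
proof -
  have "0 \<le> \<lfloor>x\<rfloor>" and "x < \<lfloor>x\<rfloor> + 1"
    using assms by auto
  then have "0 < 1 + 2 * real_of_int \<lfloor>x\<rfloor> - x"
    by linarith
  then show ?thesis
    by (simp add: newman_f_def)
qed

definition enumerates_positive_rationals :: "(nat \<Rightarrow> real) \<Rightarrow> bool" where
  "enumerates_positive_rationals u \<longleftrightarrow> u 0 = 0 \<and> bij_betw u {1..} {q \<in> \<rat>. 0 < q}"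


section \<open>The Calkin-Wilf sequence\<close>

(* The pair (a, b) stands for a vertex labelled a/b; the list gives the left child, then the
   right child. *)
fun cw_children :: "nat \<times> nat \<Rightarrow> (nat \<times> nat) list" where
  "cw_children (a, b) = [(a, a + b), (a + b, b)]"

primrec cw_level :: "nat \<Rightarrow> (nat \<times> nat) list" where
  "cw_level 0 = [(1, 1)]"
| "cw_level (Suc k) = concat (map cw_children (cw_level k))"

definition cw_levels :: "nat \<Rightarrow> (nat \<times> nat) list" where
  "cw_levels K = concat (map cw_level [0..<K])"

(* The n-th vertex, counted from 1, in the level-by-level listing of the tree. The first n
   levels contain 2 ^ n - 1 vertices, hence at least n: see length_cw_levels. *)
definition cw_vertex :: "nat \<Rightarrow> nat \<times> nat" where
  "cw_vertex n = cw_levels n ! (n - 1)"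

definition calkin_wilf :: "nat \<Rightarrow> real" where
  "calkin_wilf n = (if n = 0 then 0 else case cw_vertex n of (a, b) \<Rightarrow> real a / real b)"

lemma cw_levels_Suc: "cw_levels (Suc K) = cw_levels K @ cw_level K"
  by (simp add: cw_levels_def)

lemma cw_levels_Suc': "cw_levels (Suc K) = (1, 1) # concat (map cw_children (cw_levels K))"
proof (induction K)
  case 0
  show ?case by (simp add: cw_levels_def)
next
  case (Suc K)
  have "cw_levels (Suc (Suc K)) = cw_levels (Suc K) @ concat (map cw_children (cw_level K))"
    by (simp add: cw_levels_Suc)
  also have "\<dots> = (1, 1) # concat (map cw_children (cw_levels K @ cw_level K))"
    by (subst Suc.IH) simp
  also have "\<dots> = (1, 1) # concat (map cw_children (cw_levels (Suc K)))"
    by (simp only: cw_levels_Suc)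
  finally show ?case .
qed

lemma concat_map_cw_children:
  "length (concat (map cw_children xs)) = 2 * length xs \<and>
   (\<forall>i<length xs. concat (map cw_children xs) ! (2 * i) = cw_children (xs ! i) ! 0 \<and>
     concat (map cw_children xs) ! Suc (2 * i) = cw_children (xs ! i) ! 1)"
proof (induction xs)
  case Nil
  show ?case by simp
next
  case (Cons v xs)
  obtain a b where v: "v = (a, b)" by (cases v)
  show ?case
  proof (intro conjI allI impI)
    show "length (concat (map cw_children (v # xs))) = 2 * length (v # xs)"
      using Cons.IH v by simp
  next
    fix i
    assume i: "i < length (v # xs)"
    show "concat (map cw_children (v # xs)) ! (2 * i) = cw_children ((v # xs) ! i) ! 0"
      using Cons.IH v i by (cases i) auto
    show "concat (map cw_children (v # xs)) ! Suc (2 * i) = cw_children ((v # xs) ! i) ! 1"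
      using Cons.IH v i by (cases i) auto
  qed
qed

lemma length_cw_levels: "Suc (length (cw_levels K)) = 2 ^ K"
proof (induction K)
  case 0
  show ?case by (simp add: cw_levels_def)
next
  case (Suc K)
  then show ?case
    using concat_map_cw_children[of "cw_levels K"] by (simp add: cw_levels_Suc')
qed

lemma length_cw_levels_ge: "K \<le> length (cw_levels K)"
  using length_cw_levels[of K] less_exp[of K] by linarith

lemma cw_levels_nth_eq:
  assumes "1 \<le> n" and "n \<le> K"
  shows "cw_levels K ! (n - 1) = cw_vertex n"
  using assms(2)
proof (induction K rule: dec_induct)
  case base
  show ?case by (simp add: cw_vertex_def)
next
  case (step K)
  have "n - 1 < length (cw_levels K)"
    using assms(1) step.hyps length_cw_levels_ge[of K] by linarith
  then show ?case
    using step.IH by (simp add: cw_levels_Suc nth_append)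
qed

lemma cw_vertex_1: "cw_vertex 1 = (1, 1)"
  by (simp add: cw_vertex_def cw_levels_def)

lemma cw_vertex_children:
  assumes "1 \<le> n" and "cw_vertex n = (a, b)"
  shows "cw_vertex (2 * n) = (a, a + b)" and "cw_vertex (2 * n + 1) = (a + b, b)"
proof -
  let ?L = "cw_levels (2 * n)"
  have lt: "n - 1 < length ?L"
    using assms(1) length_cw_levels_ge[of "2 * n"] by linarith
  have v: "?L ! (n - 1) = (a, b)"
    using cw_levels_nth_eq[of n "2 * n"] assms by simp
  have S: "cw_levels (Suc (2 * n)) ! Suc j = concat (map cw_children ?L) ! j" for j
    by (simp add: cw_levels_Suc')
  have c: "concat (map cw_children ?L) ! (2 * (n - 1)) = (a, a + b)"
    "concat (map cw_children ?L) ! Suc (2 * (n - 1)) = (a + b, b)"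
    using concat_map_cw_children[of ?L] lt v by auto
  have i: "2 * n - 1 = Suc (2 * (n - 1))" "2 * n + 1 - 1 = Suc (Suc (2 * (n - 1)))"
    using assms(1) by auto
  have e: "cw_levels (Suc (2 * n)) ! (2 * n - 1) = cw_vertex (2 * n)"
    by (rule cw_levels_nth_eq) (use assms(1) in auto)
  show "cw_vertex (2 * n) = (a, a + b)"
    using e unfolding i(1) S c(1) by simp
  have e': "cw_levels (Suc (2 * n)) ! (2 * n + 1 - 1) = cw_vertex (2 * n + 1)"
    by (rule cw_levels_nth_eq) auto
  show "cw_vertex (2 * n + 1) = (a + b, b)"
    using e' unfolding i(2) S c(2) by simp
qed


section \<open>The sequence t\<close>

(* The triples are indexed from 1. For m \<ge> 2, the n with m \<in> {3 n - 1, 3 n, 3 n + 1} is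
   (m + 1) div 3; see N_triple_1 and N_triple_rec for the recursion in terms of n. All values
   of div on the components are exact. *)
function N_triple :: "nat \<Rightarrow> int \<times> int \<times> int" where
  "N_triple m =
    (if m \<le> 1 then (1, 2, 0)
     else case N_triple ((m + 1) div 3) of (a, b, c) \<Rightarrow>
       if odd b then
         (if m mod 3 = 2 then (4 * (c + 1) * a - b, 2 * a, 0)
          else if m mod 3 = 0 then (a, 2 * a + b, c + 1)
          else (2 * a + b, 2 * a + 2 * b, 0))
       else
         (if m mod 3 = 2 then (2 * (c + 1) * a - b div 2, a, 0)
          else if m mod 3 = 0 then (a, 2 * a + b, c + 1)
          else (a + b div 2, a + b, 0)))"
  by pat_completeness auto
termination
  by (relation "measure id") auto

declare N_triple.simps [simp del]

definition t_seq :: "nat \<Rightarrow> real" where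
  "t_seq n = (if n = 0 then 0 else case N_triple n of (a, b, c) \<Rightarrow> real_of_int a / real_of_int b)"

lemma N_triple_1: "N_triple 1 = (1, 2, 0)"
  by (simp add: N_triple.simps)

lemma N_triple_rec:
  assumes "1 \<le> n" and "N_triple n = (a, b, c)"
  shows "odd b \<Longrightarrow> N_triple (3 * n - 1) = (4 * (c + 1) * a - b, 2 * a, 0)"
    and "odd b \<Longrightarrow> N_triple (3 * n) = (a, 2 * a + b, c + 1)"
    and "odd b \<Longrightarrow> N_triple (3 * n + 1) = (2 * a + b, 2 * a + 2 * b, 0)"
    and "even b \<Longrightarrow> N_triple (3 * n - 1) = (2 * (c + 1) * a - b div 2, a, 0)"
    and "even b \<Longrightarrow> N_triple (3 * n) = (a, 2 * a + b, c + 1)"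
    and "even b \<Longrightarrow> N_triple (3 * n + 1) = (a + b div 2, a + b, 0)"
proof -
  obtain m where n: "n = Suc m"
    using assms(1) by (cases n) auto
  have s: "3 * n - 1 = 3 * m + 2" "3 * n = 3 * m + 3" "3 * n + 1 = 3 * m + 4"
    unfolding n by simp_all
  have d: "(3 * n - 1 + 1) div 3 = n" "(3 * n + 1) div 3 = n" "(3 * n + 1 + 1) div 3 = n"
    unfolding s unfolding n by simp_all
  have r: "(3 * n - 1) mod 3 = 2" "(3 * n) mod 3 = 0" "(3 * n + 1) mod 3 = 1"
    unfolding s by (simp_all add: mod_Suc)
  have g: "\<not> 3 * n - 1 \<le> 1" "\<not> 3 * n \<le> 1" "\<not> 3 * n + 1 \<le> 1"
    using assms(1) by linarith+
  note E = N_triple.simps[of "3 * n - 1"] N_triple.simps[of "3 * n"] N_triple.simps[of "3 * n + 1"]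
  show "odd b \<Longrightarrow> N_triple (3 * n - 1) = (4 * (c + 1) * a - b, 2 * a, 0)"
    and "even b \<Longrightarrow> N_triple (3 * n - 1) = (2 * (c + 1) * a - b div 2, a, 0)"
    unfolding E(1) d(1) r(1) assms(2) using g by simp_all
  show "odd b \<Longrightarrow> N_triple (3 * n) = (a, 2 * a + b, c + 1)"
    and "even b \<Longrightarrow> N_triple (3 * n) = (a, 2 * a + b, c + 1)"
    unfolding E(2) d(2) r(2) assms(2) using g by simp_all
  show "odd b \<Longrightarrow> N_triple (3 * n + 1) = (2 * a + b, 2 * a + 2 * b, 0)"
    and "even b \<Longrightarrow> N_triple (3 * n + 1) = (a + b div 2, a + b, 0)"
    unfolding E(3) d(3) r(3) assms(2) using g by simp_all
qed


section \<open>The sequence s\<close>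

(* For m \<ge> 2, the n with m \<in> {5 n - 3, ..., 5 n + 1} is (m + 3) div 5; see M_triple_1 and
   M_triple_rec for the recursion in terms of n. All values of div on the components are
   exact. *)
function M_triple :: "nat \<Rightarrow> int \<times> int \<times> int" where
  "M_triple m =
    (if m \<le> 1 then (1, 3, 0)
     else case M_triple ((m + 3) div 5) of (a, b, c) \<Rightarrow>
       if \<not> 3 dvd b then
         (if m mod 5 = 2 then (3 * (4 * c + 3) * a - 2 * b, 3 * (6 * c + 5) * a - 3 * b, 0)
          else if m mod 5 = 3 then ((6 * c + 5) * a - b, 6 * (c + 1) * a - b, 0)
          else if m mod 5 = 4 then (6 * (c + 1) * a - b, 3 * a, 0)
          else if m mod 5 = 0 then (a, 3 * a + b, c + 1)
          else (3 * a + b, 6 * a + 3 * b, 0))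
       else
         (if m mod 5 = 2 then ((4 * c + 3) * a - (2 * b) div 3, (6 * c + 5) * a - b, 0)
          else if m mod 5 = 3 then ((6 * c + 5) * a - b, 6 * (c + 1) * a - b, 0)
          else if m mod 5 = 4 then (2 * (c + 1) * a - b div 3, a, 0)
          else if m mod 5 = 0 then (a, 3 * a + b, c + 1)
          else (a + b div 3, 2 * a + b, 0)))"
  by pat_completeness auto
termination
  by (relation "measure id") auto

declare M_triple.simps [simp del]

definition s_seq :: "nat \<Rightarrow> real" where
  "s_seq n = (if n = 0 then 0 else case M_triple n of (a, b, c) \<Rightarrow> real_of_int a / real_of_int b)"

lemma M_triple_1: "M_triple 1 = (1, 3, 0)"
  by (simp add: M_triple.simps)

lemma M_triple_rec:
  assumes "1 \<le> n" and "M_triple n = (a, b, c)"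
  shows "\<not> 3 dvd b \<Longrightarrow>
      M_triple (5 * n - 3) = (3 * (4 * c + 3) * a - 2 * b, 3 * (6 * c + 5) * a - 3 * b, 0)"
    and "\<not> 3 dvd b \<Longrightarrow> M_triple (5 * n - 2) = ((6 * c + 5) * a - b, 6 * (c + 1) * a - b, 0)"
    and "\<not> 3 dvd b \<Longrightarrow> M_triple (5 * n - 1) = (6 * (c + 1) * a - b, 3 * a, 0)"
    and "\<not> 3 dvd b \<Longrightarrow> M_triple (5 * n) = (a, 3 * a + b, c + 1)"
    and "\<not> 3 dvd b \<Longrightarrow> M_triple (5 * n + 1) = (3 * a + b, 6 * a + 3 * b, 0)"
    and "3 dvd b \<Longrightarrow> M_triple (5 * n - 3) = ((4 * c + 3) * a - (2 * b) div 3, (6 * c + 5) * a - b, 0)"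
    and "3 dvd b \<Longrightarrow> M_triple (5 * n - 2) = ((6 * c + 5) * a - b, 6 * (c + 1) * a - b, 0)"
    and "3 dvd b \<Longrightarrow> M_triple (5 * n - 1) = (2 * (c + 1) * a - b div 3, a, 0)"
    and "3 dvd b \<Longrightarrow> M_triple (5 * n) = (a, 3 * a + b, c + 1)"
    and "3 dvd b \<Longrightarrow> M_triple (5 * n + 1) = (a + b div 3, 2 * a + b, 0)"
proof -
  obtain m where n: "n = Suc m"
    using assms(1) by (cases n) auto
  have s: "5 * n - 3 = 5 * m + 2" "5 * n - 2 = 5 * m + 3" "5 * n - 1 = 5 * m + 4" "5 * n = 5 * m + 5" "5 * n + 1 = 5 * m + 6"
    unfolding n by simp_all
  have d: "(5 * n - 3 + 3) div 5 = n" "(5 * n - 2 + 3) div 5 = n" "(5 * n - 1 + 3) div 5 = n" "(5 * n + 3) div 5 = n" "(5 * n + 1 + 3) div 5 = n"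
    unfolding s unfolding n by simp_all
  have r: "(5 * n - 3) mod 5 = 2" "(5 * n - 2) mod 5 = 3" "(5 * n - 1) mod 5 = 4" "(5 * n) mod 5 = 0" "(5 * n + 1) mod 5 = 1"
    unfolding s by (simp_all add: mod_Suc)
  have g: "\<not> 5 * n - 3 \<le> 1" "\<not> 5 * n - 2 \<le> 1" "\<not> 5 * n - 1 \<le> 1" "\<not> 5 * n \<le> 1" "\<not> 5 * n + 1 \<le> 1"
    using assms(1) by linarith+
  note E = M_triple.simps[of "5 * n - 3"] M_triple.simps[of "5 * n - 2"]
    M_triple.simps[of "5 * n - 1"] M_triple.simps[of "5 * n"] M_triple.simps[of "5 * n + 1"]
  show "\<not> 3 dvd b \<Longrightarrow>
      M_triple (5 * n - 3) = (3 * (4 * c + 3) * a - 2 * b, 3 * (6 * c + 5) * a - 3 * b, 0)"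
    and "3 dvd b \<Longrightarrow> M_triple (5 * n - 3) = ((4 * c + 3) * a - (2 * b) div 3, (6 * c + 5) * a - b, 0)"
    unfolding E(1) d(1) r(1) assms(2) using g by simp_all
  show "\<not> 3 dvd b \<Longrightarrow> M_triple (5 * n - 2) = ((6 * c + 5) * a - b, 6 * (c + 1) * a - b, 0)"
    and "3 dvd b \<Longrightarrow> M_triple (5 * n - 2) = ((6 * c + 5) * a - b, 6 * (c + 1) * a - b, 0)"
    unfolding E(2) d(2) r(2) assms(2) using g by simp_all
  show "\<not> 3 dvd b \<Longrightarrow> M_triple (5 * n - 1) = (6 * (c + 1) * a - b, 3 * a, 0)"
    and "3 dvd b \<Longrightarrow> M_triple (5 * n - 1) = (2 * (c + 1) * a - b div 3, a, 0)"
    unfolding E(3) d(3) r(3) assms(2) using g by simp_all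
  show "\<not> 3 dvd b \<Longrightarrow> M_triple (5 * n) = (a, 3 * a + b, c + 1)"
    and "3 dvd b \<Longrightarrow> M_triple (5 * n) = (a, 3 * a + b, c + 1)"
    unfolding E(4) d(4) r(4) assms(2) using g by simp_all
  show "\<not> 3 dvd b \<Longrightarrow> M_triple (5 * n + 1) = (3 * a + b, 6 * a + 3 * b, 0)"
    and "3 dvd b \<Longrightarrow> M_triple (5 * n + 1) = (a + b div 3, 2 * a + b, 0)"
    unfolding E(5) d(5) r(5) assms(2) using g by simp_all
qed

end

theory Submission
  imports Defs
begin

text \<open>
  Up to the choice of \<open>k\<close> there is only one candidate, the forward orbit of \<open>0\<close> under
  \<open>newman_step k\<close>; it is called \<open>newman_seq k\<close>. On \<open>[0, 1)\<close> this step is the Moebius map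
  \<open>h x = 1 / (k * (1 - x))\<close>, with \<open>trace\<^sup>2 / det = k\<close>. Hence \<open>h\<close> is elliptic exactly for
  \<open>k < 4\<close>, and as \<open>4 * cos\<^sup>2 (pi / r)\<close> equals \<open>1, 2, 3\<close> for \<open>r = 3, 4, 6\<close>, it then has
  the finite order \<open>r\<close>. For \<open>k \<ge> 4\<close> the orbit is trapped in \<open>[0, 1/2]\<close> and misses \<open>1\<close>
  (\<open>newman_seq_le_half\<close>).

  For \<open>k = 1, 2, 3\<close> the finite order makes the orbit self-similar. As Moebius maps,
  \<open>h (h (1 + x)) = x / (1 + k * x)\<close>, so \<open>j = r - 2\<close> further applications of \<open>h\<close>, all at points
  of \<open>[0, 1)\<close>, lead from \<open>x / (1 + k * x)\<close> to \<open>1 + x\<close>. The step that follows leads from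
  \<open>1 + x\<close> to \<open>x' / (1 + k * x')\<close>, where \<open>x'\<close> is the successor of \<open>x\<close>
  (\<open>newman_step_plus_1\<close>). Thus the orbit consists of blocks of \<open>j + 1 = 2, 3, 5\<close> terms, the
  \<open>n\<close>-th of which runs from \<open>x / (1 + k * x)\<close> to \<open>1 + x\<close> for the \<open>n\<close>-th term \<open>x\<close>
  (\<open>newman_seq_block\<close>).

  Both remaining claims follow from this block structure. First, the values of the orbit are closed
  under \<open>x \<mapsto> 1 + x\<close>, \<open>x \<mapsto> x / (1 + k * x)\<close> and \<open>h\<close>, and a Euclidean descent reaches
  every nonnegative rational from \<open>0\<close> by these operations (\<open>fraction_in_range\<close>); no value is
  repeated since the step is injective and never takes the value \<open>0\<close>. Second, the blocks are
  the rules of the three trees. The counter \<open>c\<close> in a triple \<open>(a, b, c)\<close> is the integral part of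
  the preceding term, which is exactly what is needed to run the recurrence backwards
  (\<open>codes_orbit\<close>).
\<close>

definition newman_step :: "nat \<Rightarrow> real \<Rightarrow> real" where
  "newman_step k x = newman_f x / real k"

definition newman_seq :: "nat \<Rightarrow> nat \<Rightarrow> real" where
  "newman_seq k n = (newman_step k ^^ n) 0"

lemma newman_seq_0 [simp]: "newman_seq k 0 = 0"
  by (simp add: newman_seq_def)

lemma newman_seq_Suc: "newman_seq k (Suc n) = newman_step k (newman_seq k n)"
  by (simp add: newman_seq_def)

lemma newman_seq_add: "newman_seq k (n + i) = (newman_step k ^^ i) (newman_seq k n)"
  by (simp add: newman_seq_def add.commute[of n] funpow_add)

lemma recurrence_eq_newman_seq:
  assumes "u 0 = 0" and "\<forall>n\<ge>1. u n = newman_f (u (n - 1)) / real k"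
  shows "u = newman_seq k"
proof
  fix n
  show "u n = newman_seq k n"
    using assms by (induction n) (simp_all add: newman_seq_Suc newman_step_def)
qed

lemma newman_step_pos:
  assumes "1 \<le> k" and "0 \<le> x"
  shows "0 < newman_step k x"
  using assms newman_f_pos by (simp add: newman_step_def)

lemma newman_seq_nonneg:
  assumes "1 \<le> k"
  shows "0 \<le> newman_seq k n"
  using newman_step_pos[OF assms] by (induction n) (simp_all add: newman_seq_Suc less_imp_le)

lemma newman_seq_pos:
  assumes "1 \<le> k" and "1 \<le> n"
  shows "0 < newman_seq k n"
  using newman_step_pos[OF assms(1) newman_seq_nonneg[OF assms(1)]] assms(2)
  by (cases n) (simp_all add: newman_seq_Suc)

lemma newman_step_below_1:
  assumes "0 \<le> x" and "x < 1"
  shows "newman_step k x = 1 / (real k * (1 - x))"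
proof -
  have "\<lfloor>x\<rfloor> = 0"
    using assms by (simp add: floor_eq_iff)
  then show ?thesis
    by (simp add: newman_step_def newman_f_def mult.commute)
qed

lemma newman_step_fraction:
  assumes "0 \<le> p" and "p < q"
  shows "newman_step k (p / q) = q / (real k * (q - p))"
proof -
  have "1 - p / q = (q - p) / q"
    using assms by (simp add: field_simps)
  then show ?thesis
    using assms by (simp add: newman_step_below_1)
qed


section \<open>The orbit for k at least 4\<close>

text \<open>The number \<open>1/2\<close> is the fixed point of \<open>x \<mapsto> 1 / (4 * (1 - x))\<close>; a larger \<open>k\<close> only
  lowers the values.\<close>

lemma newman_seq_le_half:
  assumes "4 \<le> k"
  shows "newman_seq k n \<le> 1 / 2"
proof (induction n)
  case 0
  show ?case by simp
next
  case (Suc n)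
  let ?x = "newman_seq k n"
  have nn: "0 \<le> ?x"
    using assms by (intro newman_seq_nonneg) simp
  have "4 * (1 / 2) \<le> real k * (1 - ?x)"
    using assms Suc.IH by (intro mult_mono) auto
  then have "1 / (real k * (1 - ?x)) \<le> 1 / 2"
    by (intro frac_le) auto
  then show ?case
    using nn Suc.IH by (simp add: newman_seq_Suc newman_step_below_1)
qed

lemma not_enumerates_if_ge_4:
  assumes "4 \<le> k"
  shows "\<not> enumerates_positive_rationals (newman_seq k)"
proof
  assume "enumerates_positive_rationals (newman_seq k)"
  then have "newman_seq k ` {1..} = {q \<in> \<rat>. 0 < q}"
    by (auto simp: enumerates_positive_rationals_def bij_betw_def)
  moreover have "(1::real) \<in> {q \<in> \<rat>. 0 < q}"
    by simp
  ultimately obtain n where "newman_seq k n = 1"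
    by (metis imageE)
  then show False
    using newman_seq_le_half[OF assms, of n] by simp
qed


section \<open>Self-similarity of the orbit\<close>

text \<open>Adding \<open>1\<close> to the argument adds \<open>1\<close> to the denominator \<open>1 + 2 * \<lfloor>x\<rfloor> - x\<close>, hence adds
  \<open>k\<close> to the reciprocal of the value.\<close>

lemma newman_step_plus_1:
  assumes "1 \<le> k" and "0 \<le> x"
  shows "newman_step k (1 + x) = newman_step k x / (1 + real k * newman_step k x)"
proof -
  define w where "w = 1 + 2 * real_of_int \<lfloor>x\<rfloor> - x"
  have "0 < w"
    using newman_f_pos[OF assms(2)] by (simp add: newman_f_def w_def)
  moreover have "\<lfloor>1 + x\<rfloor> = 1 + \<lfloor>x\<rfloor>"
    by linarith
  then have "newman_step k (1 + x) = 1 / (1 + w) / real k"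
    by (simp add: newman_step_def newman_f_def w_def algebra_simps)
  moreover have "newman_step k x = 1 / w / real k"
    by (simp add: newman_step_def newman_f_def w_def)
  moreover have "1 / (1 + w) / real k = (1 / w / real k) / (1 + real k * (1 / w / real k))"
    using \<open>0 < w\<close> assms(1) by (simp add: field_simps)
  ultimately show ?thesis
    by simp
qed

text \<open>If \<open>j\<close> steps always lead from \<open>x / (1 + k * x)\<close> to \<open>1 + x\<close>, then one more step leads to
  the start of the same path for the successor of \<open>x\<close>. So the paths belonging to consecutive terms
  are joined end to end, and together they are the whole orbit because it starts with the path of
  \<open>0\<close>.\<close>

lemma newman_seq_block:
  assumes k: "1 \<le> k"
    and circuit: "\<And>x. 0 \<le> x \<Longrightarrow> (newman_step k ^^ j) (x / (1 + real k * x)) = 1 + x"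
  shows "newman_seq k (Suc j * n + i) =
    (newman_step k ^^ i) (newman_seq k n / (1 + real k * newman_seq k n))"
proof -
  have "newman_seq k (Suc j * n) = newman_seq k n / (1 + real k * newman_seq k n)"
  proof (induction n)
    case 0
    show ?case by simp
  next
    case (Suc n)
    have "Suc j * Suc n = Suc (Suc j * n + j)"
      by simp
    then have "newman_seq k (Suc j * Suc n) = newman_step k (newman_seq k (Suc j * n + j))"
      by (simp only: newman_seq_Suc)
    also have "newman_seq k (Suc j * n + j) = 1 + newman_seq k n"
      unfolding newman_seq_add Suc.IH by (rule circuit[OF newman_seq_nonneg[OF k]])
    finally show ?case
      using newman_step_plus_1[OF k newman_seq_nonneg[OF k]] by (simp only: newman_seq_Suc)
  qed
  then show ?thesis
    by (simp only: newman_seq_add)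
qed

text \<open>All points on these paths except the last lie in \<open>[0, 1)\<close>, where the step is the elliptic map
  \<open>h\<close> of order \<open>3\<close>, \<open>4\<close> or \<open>6\<close>; a circuit under \<open>h\<close> is closed by the two passages from
  \<open>1 + x\<close> through \<open>- 1 / (k * x)\<close> to \<open>x / (1 + k * x)\<close>, which are not steps of the orbit.\<close>

lemma circuit_1:
  assumes "0 \<le> x"
  shows "newman_step 1 (x / (1 + x)) = 1 + x"
  using assms by (simp add: newman_step_fraction)

lemma circuit_2:
  assumes "0 \<le> x"
  shows "newman_step 2 (x / (1 + 2 * x)) = (1 + 2 * x) / (2 + 2 * x)"
    and "newman_step 2 ((1 + 2 * x) / (2 + 2 * x)) = 1 + x"
  using assms by (simp_all add: newman_step_fraction algebra_simps divide_simps)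

lemma circuit_3:
  assumes "0 \<le> x"
  shows "newman_step 3 (x / (1 + 3 * x)) = (1 + 3 * x) / (3 + 6 * x)"
    and "newman_step 3 ((1 + 3 * x) / (3 + 6 * x)) = (1 + 2 * x) / (2 + 3 * x)"
    and "newman_step 3 ((1 + 2 * x) / (2 + 3 * x)) = (2 + 3 * x) / (3 + 3 * x)"
    and "newman_step 3 ((2 + 3 * x) / (3 + 3 * x)) = 1 + x"
  using assms by (simp_all add: newman_step_fraction) (simp_all add: field_simps)

lemma newman_seq_1_block:
  fixes n :: nat
  defines "x \<equiv> newman_seq 1 n"
  shows "newman_seq 1 (2 * n) = x / (1 + x)"
    and "newman_seq 1 (2 * n + 1) = 1 + x"
proof -
  have x: "0 \<le> x"
    unfolding x_def by (rule newman_seq_nonneg) simp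
  have "newman_seq 1 (Suc 1 * n + i) = (newman_step 1 ^^ i) (x / (1 + real 1 * x))" for i
    unfolding x_def by (rule newman_seq_block) (use circuit_1 in simp_all)
  from this[of 0] this[of 1] show "newman_seq 1 (2 * n) = x / (1 + x)"
    and "newman_seq 1 (2 * n + 1) = 1 + x"
    using circuit_1[OF x] by (simp_all add: numeral_2_eq_2)
qed

lemma newman_seq_2_block:
  fixes n :: nat
  defines "x \<equiv> newman_seq 2 n"
  shows "newman_seq 2 (3 * n) = x / (1 + 2 * x)"
    and "newman_seq 2 (3 * n + 1) = (1 + 2 * x) / (2 + 2 * x)"
    and "newman_seq 2 (3 * n + 2) = 1 + x"
proof -
  have x: "0 \<le> x"
    unfolding x_def by (rule newman_seq_nonneg) simp
  have pow: "(newman_step 2 ^^ 2) y = newman_step 2 (newman_step 2 y)" for y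
    by (simp add: eval_nat_numeral)
  have "newman_seq 2 (Suc 2 * n + i) = (newman_step 2 ^^ i) (x / (1 + real 2 * x))" for i
    unfolding x_def by (rule newman_seq_block) (simp_all add: pow circuit_2)
  from this[of 0] this[of 1] this[of 2]
  show "newman_seq 2 (3 * n) = x / (1 + 2 * x)"
    and "newman_seq 2 (3 * n + 1) = (1 + 2 * x) / (2 + 2 * x)"
    and "newman_seq 2 (3 * n + 2) = 1 + x"
    using circuit_2[OF x] by (simp_all add: pow)
qed

lemma newman_seq_3_block:
  fixes n :: nat
  defines "x \<equiv> newman_seq 3 n"
  shows "newman_seq 3 (5 * n) = x / (1 + 3 * x)"
    and "newman_seq 3 (5 * n + 1) = (1 + 3 * x) / (3 + 6 * x)"
    and "newman_seq 3 (5 * n + 2) = (1 + 2 * x) / (2 + 3 * x)"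
    and "newman_seq 3 (5 * n + 3) = (2 + 3 * x) / (3 + 3 * x)"
    and "newman_seq 3 (5 * n + 4) = 1 + x"
proof -
  have x: "0 \<le> x"
    unfolding x_def by (rule newman_seq_nonneg) simp
  let ?s = "newman_step 3"
  have pow: "(?s ^^ 2) y = ?s (?s y)" "(?s ^^ 3) y = ?s (?s (?s y))"
    "(?s ^^ 4) y = ?s (?s (?s (?s y)))" for y
    by (simp_all add: eval_nat_numeral)
  have "newman_seq 3 (Suc 4 * n + i) = (?s ^^ i) (x / (1 + real 3 * x))" for i
    unfolding x_def by (rule newman_seq_block) (simp_all add: pow circuit_3)
  from this[of 0] this[of 1] this[of 2] this[of 3] this[of 4]
  show "newman_seq 3 (5 * n) = x / (1 + 3 * x)"
    and "newman_seq 3 (5 * n + 1) = (1 + 3 * x) / (3 + 6 * x)"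
    and "newman_seq 3 (5 * n + 2) = (1 + 2 * x) / (2 + 3 * x)"
    and "newman_seq 3 (5 * n + 3) = (2 + 3 * x) / (3 + 3 * x)"
    and "newman_seq 3 (5 * n + 4) = 1 + x"
    using circuit_3[OF x] by (simp_all add: pow)
qed


section \<open>The orbit meets every positive rational exactly once\<close>

text \<open>Equal values force \<open>x - y = 2 * (\<lfloor>x\<rfloor> - \<lfloor>y\<rfloor>)\<close>. The difference of the fractional parts
  is then the integer \<open>\<lfloor>x\<rfloor> - \<lfloor>y\<rfloor>\<close>, so it vanishes.\<close>

lemma newman_step_inj:
  assumes k: "1 \<le> k" and eq: "newman_step k x = newman_step k y"
  shows "x = y"
proof -
  have "1 + 2 * real_of_int \<lfloor>x\<rfloor> - x = 1 + 2 * real_of_int \<lfloor>y\<rfloor> - y"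
    using eq k by (simp add: newman_step_def newman_f_def)
  then have d: "x - y = 2 * (real_of_int \<lfloor>x\<rfloor> - real_of_int \<lfloor>y\<rfloor>)"
    by simp
  define i j where "i = \<lfloor>x\<rfloor>" and "j = \<lfloor>y\<rfloor>"
  have "x - y = 2 * (real_of_int i - real_of_int j)" "real_of_int i \<le> x" "x < real_of_int i + 1"
    "real_of_int j \<le> y" "y < real_of_int j + 1"
    using d by (simp_all add: i_def j_def)
  then have "i < j + 1" and "j < i + 1"
    by simp_all
  then have "\<lfloor>x\<rfloor> = \<lfloor>y\<rfloor>"
    unfolding i_def j_def by linarith
  with d show ?thesis
    by (simp only: diff_self mult_zero_right right_minus_eq)
qed

lemma newman_seq_inj:
  assumes "1 \<le> k"
  shows "inj (newman_seq k)"
proof (rule linorder_injI)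
  fix m n :: nat
  assume "m < n"
  then show "newman_seq k m \<noteq> newman_seq k n"
  proof (induction m arbitrary: n)
    case 0
    then show ?case
      using newman_seq_pos[OF assms, of n] by simp
  next
    case (Suc m)
    then obtain l where "n = Suc l" "m < l"
      by (cases n) auto
    with Suc.IH[of l] show ?case
      using newman_step_inj[OF assms] by (auto simp: newman_seq_Suc)
  qed
qed

lemma newman_seq_Rats: "newman_seq k n \<in> \<rat>"
  by (induction n) (simp_all add: newman_seq_Suc newman_step_def newman_f_def)

lemma newman_seq_range_closed:
  assumes k: "k \<in> {1, 2, 3}" and x: "x \<in> range (newman_seq k)"
  shows "1 + x \<in> range (newman_seq k)"
    and "x / (1 + real k * x) \<in> range (newman_seq k)"
proof -
  obtain n where n: "x = newman_seq k n"
    using x by auto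
  have "\<exists>m. newman_seq k m = 1 + x"
    using k newman_seq_1_block(2)[of n] newman_seq_2_block(3)[of n] newman_seq_3_block(5)[of n]
    unfolding n by blast
  then show "1 + x \<in> range (newman_seq k)"
    by (metis rangeI)
  have "newman_seq 1 (2 * n) = newman_seq 1 n / (1 + real 1 * newman_seq 1 n)"
    "newman_seq 2 (3 * n) = newman_seq 2 n / (1 + real 2 * newman_seq 2 n)"
    "newman_seq 3 (5 * n) = newman_seq 3 n / (1 + real 3 * newman_seq 3 n)"
    using newman_seq_1_block(1) newman_seq_2_block(1) newman_seq_3_block(1) by simp_all
  then have "\<exists>m. newman_seq k m = x / (1 + real k * x)"
    using k unfolding n by blast
  then show "x / (1 + real k * x) \<in> range (newman_seq k)"
    by (metis rangeI)
qed

lemma newman_step_in_range: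
  assumes "x \<in> range (newman_seq k)"
  shows "newman_step k x \<in> range (newman_seq k)"
  using assms by (auto simp flip: newman_seq_Suc)

text \<open>
  The descent that replaces the Euclidean algorithm. A rational \<open>y\<close> is written as
  \<open>e * p / (k * q)\<close> with \<open>e * e' = k\<close>; the choice \<open>e = k\<close> is the ordinary fraction \<open>p / q\<close>. Both
  kinds are needed because the inverse of \<open>h\<close> sends \<open>e * p / (k * q)\<close> to
  \<open>e' * (e * p - q) / (k * p)\<close>, interchanging \<open>e\<close> and \<open>e'\<close>: keeping track of the factor \<open>k\<close> in
  this way, rather than clearing it, is what makes \<open>p + q\<close> a measure that decreases.
  The cases are, in terms of \<open>y\<close>:
  \<open>y = 0\<close>; \<open>0 < y < 1/k\<close>, reached by \<open>x \<mapsto> x / (1 + k * x)\<close>; \<open>1 \<le> y\<close>, reached by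
  \<open>x \<mapsto> 1 + x\<close>; \<open>1/k \<le> y < min 1 (2/k)\<close>, reached by one step; and \<open>2/k \<le> y < 1\<close>, possible only for
  \<open>k = 3\<close>, reached by three steps.
\<close>

lemma fraction_in_range:
  fixes p q e e' :: int
  assumes k: "k \<in> {1, 2, 3}" and ee': "e * e' = int k" and e: "0 < e" "0 < e'"
    and p: "0 \<le> p" and q: "0 < q"
  shows "(real_of_int e * real_of_int p) / (real k * real_of_int q) \<in> range (newman_seq k)"
  using ee' e p q
proof (induction "nat (p + q)" arbitrary: p q e e' rule: less_induct)
  case less
  let ?S = "range (newman_seq k)"
  have k1: "0 < real k"
    using k by auto
  have kr: "real k = real_of_int e * real_of_int e'"
    using less.prems(1) by (metis of_int_mult of_int_of_nat_eq)
  have e_nz [simp]: "e \<noteq> 0" "e' \<noteq> 0"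
    using less.prems(2,3) by auto
  consider "p = 0" | "0 < p" "e * p < q" | "0 < p" "e' * q \<le> p"
    | "0 < p" "q \<le> e * p" "p < e' * q" "e * p < 2 * q"
    | "0 < p" "p < e' * q" "2 * q \<le> e * p"
    using less.prems by linarith
  then show ?case
  proof cases
    case 1
    have "newman_seq k 0 \<in> ?S"
      by blast
    then show ?thesis
      using 1 by simp
  next
    case 2
    have "0 < e * p"
      using 2 less.prems(2) by simp
    then have "(e * p) / (k * (q - e * p)) \<in> ?S" (is "?x \<in> _")
      using less.hyps[of p "q - e * p" e e'] less.prems 2 by simp
    from newman_seq_range_closed(2)[OF k this]
    have "?x / (1 + real k * ?x) \<in> ?S" .
    also have "?x / (1 + real k * ?x) = (e * p) / (k * q)"
    proof -
      have "real_of_int q - real_of_int e * real_of_int p \<noteq> 0"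
        using 2(2) by (metis less_irrefl of_int_diff of_int_eq_0_iff of_int_mult right_minus_eq)
      then show ?thesis
        using k1 less.prems(5) by (simp add: field_simps)
    qed
    finally show ?thesis by simp
  next
    case 3
    have "0 < e' * q"
      using less.prems(3,5) by simp
    then have "(e * (p - e' * q)) / (k * q) \<in> ?S" (is "?x \<in> _")
      using less.hyps[of "p - e' * q" q e e'] less.prems 3 by simp
    from newman_seq_range_closed(1)[OF k this]
    have "1 + ?x \<in> ?S" .
    also have "1 + ?x = (e * p) / (k * q)"
      using less.prems(5) k1 by (simp add: field_simps) (simp add: kr)
    finally show ?thesis by simp
  next
    case 4
    have "(e' * (e * p - q)) / (k * p) \<in> ?S" (is "?x \<in> _")
      using less.hyps[of "e * p - q" p e' e] less.prems 4 by (simp add: mult.commute)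
    from newman_step_in_range[OF this]
    have "newman_step k ?x \<in> ?S" .
    also have "?x = (e' * (e * p - q)) / (e' * (e * p))"
      by (simp add: kr)
    also have "\<dots> = (e * p - q) / (e * p)"
      by simp
    also have "newman_step k \<dots> = (e * p) / (k * q)"
    proof -
      have "0 \<le> real_of_int (e * p - q)" "real_of_int (e * p - q) < real_of_int (e * p)"
        using 4 less.prems(5) by (simp_all only: of_int_0_le_iff of_int_less_iff)
      then show ?thesis
        by (simp add: newman_step_fraction)
    qed
    finally show ?thesis by simp
  next
    case 5
    have "e' * (2 * q) \<le> e' * (e * p)"
      using 5 less.prems(3) by simp
    also have "\<dots> = int k * p"
      using less.prems(1) by (simp add: algebra_simps)
    finally have e'q: "e' * (2 * q) \<le> int k * p" .
    have "e * p < e * (e' * q)"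
      using 5 less.prems(2) by simp
    also have "\<dots> = int k * q"
      using less.prems(1) by (simp add: algebra_simps)
    finally have ep: "e * p < int k * q" .
    have "2 * q < int k * q"
      using ep 5(3) less.prems(5) by linarith
    then have "2 < int k"
      using less.prems(5) by simp
    then have k3: "k = 3"
      using k by auto
    \<comment> \<open>A single step back need not decrease the sum here. The witness is the third inverse iterate of
      \<open>h\<close> at \<open>y\<close>, that is \<open>(3 * y - 2) / (6 * y - 3)\<close>, which lies in \<open>[0, 1/3)\<close>.\<close>
    have "(e' * (e * p - 2 * q)) / (k * (2 * p - e' * q)) \<in> ?S" (is "?x \<in> _")
      using less.hyps[of "e * p - 2 * q" "2 * p - e' * q" e' e] less.prems 5 e'q ep
      unfolding k3 by (simp add: mult.commute)
    then have "newman_step k (newman_step k (newman_step k ?x)) \<in> ?S"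
      by (intro newman_step_in_range)
    also have "newman_step k (newman_step k (newman_step k ?x)) = (e * p) / (k * q)"
    proof -
      define P Q where "P = real_of_int (e * p)" and "Q = real_of_int q"
      have PQ: "0 < Q" "2 * Q \<le> P"
        using less.prems(5) 5(3) unfolding P_def Q_def by linarith+
      have "?x = (e' * (e * p - 2 * q)) / (e' * (e * (2 * p - e' * q)))"
        by (simp add: kr)
      also have "\<dots> = (e * p - 2 * q) / (e * (2 * p - e' * q))"
        by simp
      also have "\<dots> = (e * p - 2 * q) / (2 * (e * p) - (e * e') * q)"
        by (simp add: algebra_simps)
      also have "\<dots> = (P - 2 * Q) / (2 * P - 3 * Q)"
        using kr k3 by (simp add: P_def Q_def)
      also have "newman_step k \<dots> = (2 * P - 3 * Q) / (3 * P - 3 * Q)"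
        using PQ k3 by (simp add: newman_step_fraction)
      also have "newman_step k \<dots> = (P - Q) / P"
        using PQ k3 by (simp add: newman_step_fraction) (simp add: field_simps)
      also have "newman_step k \<dots> = P / (3 * Q)"
        using PQ k3 by (simp add: newman_step_fraction)
      finally show ?thesis
        using k3 by (simp add: P_def Q_def)
    qed
    finally show ?thesis by simp
  qed
qed

lemma newman_seq_enumerates:
  assumes k: "k \<in> {1, 2, 3}"
  shows "enumerates_positive_rationals (newman_seq k)"
proof -
  have k1: "1 \<le> k"
    using k by auto
  have "newman_seq k ` {1..} = {q \<in> \<rat>. 0 < q}"
  proof (intro equalityI subsetI)
    fix y
    assume "y \<in> newman_seq k ` {1..}"
    then show "y \<in> {q \<in> \<rat>. 0 < q}"
      using newman_seq_pos[OF k1] newman_seq_Rats by auto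
  next
    fix y :: real
    assume "y \<in> {q \<in> \<rat>. 0 < q}"
    then have "y \<in> \<rat>" "0 < y"
      by auto
    then obtain p q :: int where q: "0 < q" and y: "y = p / q"
      by (metis Rats_cases')
    have "0 < p"
      using \<open>0 < y\<close> q by (simp add: y zero_less_divide_iff)
    then have "(real_of_int (int k) * p) / (real k * q) \<in> range (newman_seq k)"
      using q k1 by (intro fraction_in_range[OF k, where e' = 1]) auto
    then have "y \<in> range (newman_seq k)"
      using k1 by (simp add: y)
    then obtain n where n: "y = newman_seq k n"
      by auto
    with \<open>0 < y\<close> have "n \<noteq> 0"
      by (metis less_irrefl newman_seq_0)
    with n show "y \<in> newman_seq k ` {1..}"
      by auto
  qed
  moreover have "inj_on (newman_seq k) {1..}"
    using newman_seq_inj[OF k1] by (rule inj_on_subset) simp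
  ultimately show ?thesis
    by (simp add: enumerates_positive_rationals_def bij_betw_def)
qed


section \<open>The trees list the orbits\<close>

lemma calkin_wilf_eq: "calkin_wilf = newman_seq 1"
proof
  fix m
  have "0 < fst (cw_vertex m) \<and> 0 < snd (cw_vertex m) \<and>
    newman_seq 1 m = fst (cw_vertex m) / snd (cw_vertex m)" if "1 \<le> m"
    using that
  proof (induction m rule: less_induct)
    case (less m)
    show ?case
    proof (cases "m = 1")
      case True
      then show ?thesis
        using cw_vertex_1 newman_seq_1_block(2)[of 0] by simp
    next
      case False
      define n where "n = m div 2"
      have n: "1 \<le> n" "n < m" and m: "m = 2 * n \<or> m = 2 * n + 1"
        using less.prems False unfolding n_def by auto
      obtain a b where v: "cw_vertex n = (a, b)"
        by (cases "cw_vertex n")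
      have IH: "0 < a" "0 < b" "newman_seq 1 n = a / b"
        using less.IH[OF n(2,1)] v by simp_all
      have "newman_seq 1 (2 * n) = a / (a + b)" "newman_seq 1 (2 * n + 1) = (a + b) / b"
        unfolding newman_seq_1_block IH(3) using IH(1,2) by (simp_all add: field_simps)
      then show ?thesis
        using m cw_vertex_children[OF n(1) v] IH(1,2) by auto
    qed
  qed
  then show "calkin_wilf m = newman_seq 1 m"
    by (simp add: calkin_wilf_def split: prod.split)
qed

text \<open>A term together with the integral part of its predecessor determines the predecessor. This is why
  the triples carry a third component.\<close>

lemma newman_seq_inverse:
  assumes "1 \<le> k" and "1 \<le> n"
  shows "1 / (real k * newman_seq k n) =
    1 + 2 * real_of_int \<lfloor>newman_seq k (n - 1)\<rfloor> - newman_seq k (n - 1)"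
  using assms by (cases n) (simp_all add: newman_seq_Suc newman_step_def newman_f_def)

definition codes_orbit :: "nat \<Rightarrow> (nat \<Rightarrow> int \<times> int \<times> int) \<Rightarrow> nat \<Rightarrow> bool" where
  "codes_orbit k T n \<longleftrightarrow> (case T n of (a, b, c) \<Rightarrow>
     newman_seq k n = real_of_int a / real_of_int b \<and> c = \<lfloor>newman_seq k (n - 1)\<rfloor>)"

text \<open>Division by \<open>0\<close> gives \<open>0\<close>, so positivity of the term excludes that \<open>a\<close> or \<open>b\<close>
  vanishes.\<close>

lemma codes_orbitD:
  assumes "1 \<le> k" and "1 \<le> n" and "codes_orbit k T n" and "T n = (a, b, c)"
  shows "newman_seq k n = real_of_int a / real_of_int b"
    and "a \<noteq> 0" and "b \<noteq> 0"
    and "c = \<lfloor>newman_seq k (n - 1)\<rfloor>"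
    and "newman_seq k (n - 1) = 1 + 2 * real_of_int c - real_of_int b / (real k * real_of_int a)"
proof -
  show u: "newman_seq k n = real_of_int a / real_of_int b" and c: "c = \<lfloor>newman_seq k (n - 1)\<rfloor>"
    using assms(3,4) by (simp_all add: codes_orbit_def)
  show "a \<noteq> 0" "b \<noteq> 0"
    using newman_seq_pos[OF assms(1,2)] unfolding u by auto
  show "newman_seq k (n - 1) = 1 + 2 * real_of_int c - real_of_int b / (real k * real_of_int a)"
    using newman_seq_inverse[OF assms(1,2)] unfolding u c[symmetric] by simp
qed

text \<open>The middle and right children of vertex \<open>n\<close> open the block of \<open>x\<close>, the \<open>n\<close>-th term of the
  orbit, while its left child is the last entry \<open>1 + y\<close> of the block of the preceding term \<open>y\<close>.
  Since the triple at \<open>n\<close> determines \<open>y\<close>, both are functions of \<open>(a, b, c)\<close>. The integral part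
  behind the third component is \<open>0\<close> except for the middle child, whose predecessor is \<open>1 + y\<close>. The
  parity of \<open>b\<close> only decides whether a factor \<open>2\<close> is cancelled.\<close>

lemma N_triple_codes_orbit:
  assumes "1 \<le> m"
  shows "codes_orbit 2 N_triple m"
  using assms
proof (induction m rule: less_induct)
  case (less m)
  show ?case
  proof (cases "m = 1")
    case True
    then show ?thesis
      using N_triple_1 newman_seq_2_block(2)[of 0] by (simp add: codes_orbit_def)
  next
    case False
    define n where "n = (m + 1) div 3"
    have n: "1 \<le> n" "n < m" and m: "m = 3 * n - 1 \<or> m = 3 * n \<or> m = 3 * n + 1"
      using less.prems False unfolding n_def by auto
    obtain a b c where T: "N_triple n = (a, b, c)"
      by (cases "N_triple n")
    obtain l where l: "n = Suc l"
      using n(1) by (cases n) auto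
    define x y where "x = newman_seq 2 n" and "y = newman_seq 2 l"
    have x: "0 \<le> x" and y: "0 \<le> y"
      unfolding x_def y_def by (rule newman_seq_nonneg; simp)+
    note D = codes_orbitD[OF _ n(1) less.IH[OF n(2,1)] T, folded x_def, unfolded l diff_Suc_1,
        folded y_def, simplified]
    note block = newman_seq_2_block[of n, folded x_def] newman_seq_2_block[of l, folded y_def]
    have cancel: "real_of_int (2 * s) / real_of_int (2 * t) = s / t" for s t
      by simp
    have idx: "3 * n - 1 = 3 * l + 2" "3 * l + 2 - 1 = 3 * l + 1"
      using l by simp_all
    have fl: "\<lfloor>newman_seq 2 (3 * n - 1 - 1)\<rfloor> = 0" "\<lfloor>newman_seq 2 (3 * n - 1)\<rfloor> = c + 1"
      "\<lfloor>newman_seq 2 (3 * n)\<rfloor> = 0"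
      unfolding idx block using x y by (simp_all add: floor_eq_iff D(4))
    have "1 + y = (4 * (c + 1) * a - b) / (2 * a)"
      using D(2) by (simp add: D(5) field_simps)
    moreover have "1 + 2 * x = (2 * a + b) / b" "2 + 2 * x = (2 * a + 2 * b) / b"
      using D(3) by (simp_all add: D(1) field_simps)
    ultimately have val: "newman_seq 2 (3 * n - 1) = (4 * (c + 1) * a - b) / (2 * a)"
      "newman_seq 2 (3 * n) = a / (2 * a + b)"
      "newman_seq 2 (3 * n + 1) = (2 * a + b) / (2 * a + 2 * b)"
      unfolding idx block using D(3) by (simp_all add: D(1))
    show ?thesis
    proof (cases "odd b")
      case True
      then show ?thesis
        using m N_triple_rec(1-3)[OF n(1) T] val fl by (auto simp: codes_orbit_def)
    next
      case False
      then obtain d where d: "b = 2 * d"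
        by (auto elim: evenE)
      have "newman_seq 2 (3 * n - 1) = (2 * (2 * (c + 1) * a - d)) / (2 * a)"
        "newman_seq 2 (3 * n + 1) = (2 * (a + d)) / (2 * (a + b))"
        unfolding val d by (simp_all add: algebra_simps)
      then have "newman_seq 2 (3 * n - 1) = (2 * (c + 1) * a - d) / a"
        "newman_seq 2 (3 * n + 1) = (a + d) / (a + b)"
        by (simp_all only: cancel)
      with d show ?thesis
        using m N_triple_rec(4-6)[OF n(1) T] val(2) fl False by (auto simp: codes_orbit_def)
    qed
  qed
qed

text \<open>The same argument with blocks of five: the first three children of vertex \<open>n\<close> are the last three
  entries of the block of the preceding term \<open>y\<close>, and the last two children are the first two
  entries of the block of the \<open>n\<close>-th term \<open>x\<close>. Divisibility of \<open>b\<close> by \<open>3\<close> decides about a common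
  factor \<open>3\<close>.\<close>

lemma M_triple_codes_orbit:
  assumes "1 \<le> m"
  shows "codes_orbit 3 M_triple m"
  using assms
proof (induction m rule: less_induct)
  case (less m)
  show ?case
  proof (cases "m = 1")
    case True
    then show ?thesis
      using M_triple_1 newman_seq_3_block(2)[of 0] by (simp add: codes_orbit_def)
  next
    case False
    define n where "n = (m + 3) div 5"
    have n: "1 \<le> n" "n < m"
      and m: "m = 5 * n - 3 \<or> m = 5 * n - 2 \<or> m = 5 * n - 1 \<or> m = 5 * n \<or> m = 5 * n + 1"
      using less.prems False unfolding n_def by presburger+
    obtain a b c where T: "M_triple n = (a, b, c)"
      by (cases "M_triple n")
    obtain l where l: "n = Suc l"
      using n(1) by (cases n) auto
    define x y where "x = newman_seq 3 n" and "y = newman_seq 3 l"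
    have x: "0 \<le> x" and y: "0 \<le> y"
      unfolding x_def y_def by (rule newman_seq_nonneg; simp)+
    note D = codes_orbitD[OF _ n(1) less.IH[OF n(2,1)] T, folded x_def, unfolded l diff_Suc_1,
        folded y_def, simplified]
    note block = newman_seq_3_block[of n, folded x_def] newman_seq_3_block[of l, folded y_def]
    have cancel: "real_of_int (3 * s) / real_of_int (3 * t) = s / t" for s t
      by simp
    have idx: "5 * n - 3 = 5 * l + 2" "5 * n - 2 = 5 * l + 3" "5 * n - 1 = 5 * l + 4"
      "5 * l + 2 - 1 = 5 * l + 1" "5 * l + 3 - 1 = 5 * l + 2" "5 * l + 4 - 1 = 5 * l + 3"
      using l by simp_all
    have fl: "\<lfloor>newman_seq 3 (5 * n - 3 - 1)\<rfloor> = 0" "\<lfloor>newman_seq 3 (5 * n - 2 - 1)\<rfloor> = 0"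
      "\<lfloor>newman_seq 3 (5 * n - 1 - 1)\<rfloor> = 0" "\<lfloor>newman_seq 3 (5 * n - 1)\<rfloor> = c + 1"
      "\<lfloor>newman_seq 3 (5 * n)\<rfloor> = 0"
      unfolding idx block using x y by (simp_all add: floor_eq_iff D(4))
    have "1 + y = (6 * (c + 1) * a - b) / (3 * a)"
      "1 + 2 * y = (3 * (4 * c + 3) * a - 2 * b) / (3 * a)"
      "2 + 3 * y = (3 * (6 * c + 5) * a - 3 * b) / (3 * a)"
      "3 + 3 * y = (3 * (6 * (c + 1) * a - b)) / (3 * a)"
      using D(2) by (simp_all add: D(5) field_simps)
    moreover have "1 + 3 * x = (3 * a + b) / b" "3 + 6 * x = (6 * a + 3 * b) / b"
      using D(3) by (simp_all add: D(1) field_simps)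
    moreover have "3 * (6 * c + 5) * a - 3 * b = 3 * ((6 * c + 5) * a - b)"
      by simp
    ultimately have val:
      "newman_seq 3 (5 * n - 3) = (3 * (4 * c + 3) * a - 2 * b) / (3 * (6 * c + 5) * a - 3 * b)"
      "newman_seq 3 (5 * n - 2) = (3 * ((6 * c + 5) * a - b)) / (3 * (6 * (c + 1) * a - b))"
      "newman_seq 3 (5 * n - 1) = (6 * (c + 1) * a - b) / (3 * a)"
      "newman_seq 3 (5 * n) = a / (3 * a + b)"
      "newman_seq 3 (5 * n + 1) = (3 * a + b) / (6 * a + 3 * b)"
      unfolding idx block using D(2,3) by (simp_all add: D(1))
    have val2: "newman_seq 3 (5 * n - 2) = ((6 * c + 5) * a - b) / (6 * (c + 1) * a - b)"
      unfolding val(2) by (simp only: cancel)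
    show ?thesis
    proof (cases "3 dvd b")
      case False
      then show ?thesis
        using m M_triple_rec(1-5)[OF n(1) T] val(1,3-5) val2 fl by (auto simp: codes_orbit_def)
    next
      case True
      then obtain d where d: "b = 3 * d"
        by (auto elim: dvdE)
      have "newman_seq 3 (5 * n - 3) = (3 * ((4 * c + 3) * a - 2 * d)) / (3 * ((6 * c + 5) * a - b))"
        "newman_seq 3 (5 * n - 1) = (3 * (2 * (c + 1) * a - d)) / (3 * a)"
        "newman_seq 3 (5 * n + 1) = (3 * (a + d)) / (3 * (2 * a + b))"
        unfolding val d by (simp_all add: algebra_simps)
      then have "newman_seq 3 (5 * n - 3) = ((4 * c + 3) * a - 2 * d) / ((6 * c + 5) * a - b)"
        "newman_seq 3 (5 * n - 1) = (2 * (c + 1) * a - d) / a"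
        "newman_seq 3 (5 * n + 1) = (a + d) / (2 * a + b)"
        by (simp_all only: cancel)
      moreover have "2 * b div 3 = 2 * d" "b div 3 = d"
        using d by simp_all
      ultimately show ?thesis
        using m val(4) val2 fl M_triple_rec(6-10)[OF n(1) T True]
        by (elim disjE) (simp_all only: codes_orbit_def prod.case simp_thms diff_Suc_1
            add_diff_cancel_right' of_int_0)
    qed
  qed
qed

lemma t_seq_eq: "t_seq = newman_seq 2"
proof
  fix n
  show "t_seq n = newman_seq 2 n"
    using N_triple_codes_orbit[of n]
    by (cases "n = 0") (auto simp: t_seq_def codes_orbit_def split: prod.splits)
qed

lemma s_seq_eq: "s_seq = newman_seq 3"
proof
  fix n
  show "s_seq n = newman_seq 3 n"
    using M_triple_codes_orbit[of n]
    by (cases "n = 0") (auto simp: s_seq_def codes_orbit_def split: prod.splits)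
qed

theorem mainTheorem3:
  fixes u :: "nat \<Rightarrow> real"
  shows "(u 0 = 0 \<and>
          (\<exists>k::nat. 1 \<le> k \<and> (\<forall>n\<ge>1. u n = newman_f (u (n - 1)) / real k)) \<and>
          enumerates_positive_rationals u)
         \<longleftrightarrow> (u = calkin_wilf \<or> u = t_seq \<or> u = s_seq)"
    (is "?L \<longleftrightarrow> ?R")
proof
  assume L: ?L
  then obtain k where k: "1 \<le> k" and rec: "\<forall>n\<ge>1. u n = newman_f (u (n - 1)) / real k"
    by blast
  have u: "u = newman_seq k"
    using recurrence_eq_newman_seq L rec by blast
  then have "\<not> 4 \<le> k"
    using not_enumerates_if_ge_4 L by blast
  then have "k = 1 \<or> k = 2 \<or> k = 3"
    using k by linarith
  then show ?R
    using u calkin_wilf_eq t_seq_eq s_seq_eq by metis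
next
  assume ?R
  then obtain k where k: "k \<in> {1, 2, 3}" and u: "u = newman_seq k"
    using calkin_wilf_eq t_seq_eq s_seq_eq by blast
  have "u n = newman_f (u (n - 1)) / real k" if "1 \<le> n" for n
    using that by (cases n) (simp_all add: u newman_seq_Suc newman_step_def)
  moreover have "1 \<le> k"
    using k by auto
  ultimately show ?L
    using newman_seq_enumerates[OF k] by (auto simp: u)
qed

end
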